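(* Let $\Gamma=(V\uplus A,E,\alpha,c,\lambda)$ be a gainy marked network with at least all sinks marked. Then the polyhedron $\mathcal{C}(\Gamma)\subseteq\mathbb{R}^V$ is anti-blocking.
   Context: A convex polyhedron $Q\subseteq\mathbb{R}^V_{\ge0}$ is anti-blocking if for all $y\in Q$ and $x\in\mathbb{R}^V_{\ge0}$ with $x\le y$ componentwise one has $x\in Q$. A marked network $\Gamma=(V\uplus A,E,\alpha,c,\lambda)$ consists of a finite loop-free directed multigraph on the node set $V\uplus A$ with edge set $E$ (nodes in $A$ are called marked, nodes in $V$ unmarked), weights $\alpha_e,c_e\in\mathbb{R}$ with $\alpha_e>0$ for each edge $e\in E$, and a marking $\lambda\in\mathbb{R}^A$. For $x\in\mathbb{R}^V$ one sets $x_a:=\lambda_a$ for $a\in A$. A sink is a node without outgoing edges; "all sinks marked" means every sink lies in $A$. A path is a finite walk with pairwise distinct nodes (length $0$ allowed). A cycle is a finite walk $v_1\xrightarrow{e_1}v_2\to\cdots\xrightarrow{e_r}v_{r+1}=v_1$ ($r\ge 1$) with $v_1,\dots,v_r$ pairwise distinct. The weight of a finite walk with edges $e_1,\dots,e_r$ is $\prod_{i=1}^r\alpha_{e_i}$. The network is gainy if every cycle $C$ has weight $\alpha(C)<1$. $\mathcal{W}$ is the set consisting of all finite walks $v_1\xrightarrow{e_1}\cdots\xrightarrow{e_r}v_{r+1}$ ($r\ge0$) with $v_i\in V$ for $i\le r$ and $v_{r+1}\in A$, and all infinite walks $v_1\xrightarrow{e_1}v_2\xrightarrow{e_2}\cdots$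 with all $v_i\in V$. For $W\in\mathcal{W}$ and $x\in\mathbb{R}^V$: if $W$ is finite, $$\Sigma(W)(x)=\sum_{k=1}^r\Big(\prod_{j=1}^{k-1}\alpha_{e_j}\Big)(x_{v_k}+c_{e_k})+\Big(\prod_{j=1}^r\alpha_{e_j}\Big)x_{v_{r+1}};$$ if $W$ is infinite, $\Sigma(W)(x)=\sum_{k=1}^\infty\big(\prod_{j=1}^{k-1}\alpha_{e_j}\big)(x_{v_k}+c_{e_k})$ (for gainy networks this series converges absolutely). $\widehat{\mathcal{W}}\subseteq\mathcal{W}$ is the subset of walks that are either a path (necessarily ending in a marked node) or a monocycle, i.e. an infinite walk of the form $v_1\xrightarrow{e_1}\cdots\xrightarrow{e_{s-1}}v_s\xrightarrow{e_s}\cdots\xrightarrow{e_{r-1}}v_r\xrightarrow{e_r}v_s\xrightarrow{e_s}\cdots$ which after reaching $v_s$ repeats the cycle $v_s\xrightarrow{e_s}\cdots\xrightarrow{e_{r-1}}v_r\xrightarrow{e_r}v_s$ forever, with $v_1,\dots,v_r\in V$ pairwise distinct and $1\le s\le r$. The polyhedron $\mathcal{C}(\Gamma)\subseteq\mathbb{R}^V$ is the set of all $y\in\mathbb{R}^V$ with $y\ge 0$ (componentwise) and $\alpha_e\Sigma(W)(y)+c_e\le\lambda_a$ for each $a\in A$, each edge $e$ starting in $a$, and each $W\in\widehat{\mathcal{W}}$ starting in the end node of $e$. *)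

theory Defs
  imports "HOL-Analysis.Analysis" "Graph_Theory.Arc_Walk"
begin

section \<open>Anti-blocking polyhedra\<close>

text \<open>
  For a subset \<open>V\<close> of a finite index type, \<open>\<real>\<^sup>V\<close> is realised as the coordinate subspace of
  \<open>real ^ 'n\<close> of the vectors supported on \<open>V\<close>. This allows arbitrary finite \<open>V\<close>, including the
  empty set, while polyhedra remain those of the library.
\<close>

definition coord_space :: "'n::finite set \<Rightarrow> (real ^ 'n) set" where
  "coord_space V = {x. \<forall>i. i \<notin> V \<longrightarrow> x $ i = 0}"

definition orthant :: "'n::finite set \<Rightarrow> (real ^ 'n) set" where
  "orthant V = {x \<in> coord_space V. \<forall>i\<in>V. 0 \<le> x $ i}"

definition anti_blocking :: "'n::finite set \<Rightarrow> (real ^ 'n) set \<Rightarrow> bool" where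
  "anti_blocking V Q \<longleftrightarrow>
     polyhedron Q \<and> Q \<subseteq> orthant V \<and>
     (\<forall>y\<in>Q. \<forall>x\<in>orthant V. (\<forall>i\<in>V. x $ i \<le> y $ i) \<longrightarrow> x \<in> Q)"


section \<open>Marked networks\<close>

text \<open>
  The node set \<open>V \<uplus> A\<close> is the vertex set of the underlying digraph; \<open>A\<close> is \<^term>\<open>marked\<close> and
  \<open>V\<close> is its complement in the vertex set. Only the values of \<open>marking\<close> on \<open>A\<close> and of
  \<open>alpha\<close> and \<open>cost\<close> on the arcs matter.
\<close>

record ('n, 'e) network =
  graph :: "('n, 'e) pre_digraph"
  marked :: "'n set"
  alpha :: "'e \<Rightarrow> real"
  cost :: "'e \<Rightarrow> real"
  marking :: "'n \<Rightarrow> real"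

definition unmarked :: "('n, 'e) network \<Rightarrow> 'n set" where
  "unmarked N = verts (graph N) - marked N"

definition marked_network :: "('n, 'e) network \<Rightarrow> bool" where
  "marked_network N \<longleftrightarrow>
     fin_digraph (graph N) \<and> loopfree_digraph (graph N) \<and>
     marked N \<subseteq> verts (graph N) \<and>
     (\<forall>e \<in> arcs (graph N). 0 < alpha N e)"

definition sink :: "('n, 'e) pre_digraph \<Rightarrow> 'n \<Rightarrow> bool" where
  "sink G v \<longleftrightarrow> v \<in> verts G \<and> out_arcs G v = {}"

definition all_sinks_marked :: "('n, 'e) network \<Rightarrow> bool" where
  "all_sinks_marked N \<longleftrightarrow> (\<forall>v. sink (graph N) v \<longrightarrow> v \<in> marked N)"

definition walk_weight :: "('n, 'e) network \<Rightarrow> 'e list \<Rightarrow> real" where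
  "walk_weight N p = (\<Prod>e\<leftarrow>p. alpha N e)"

definition gainy :: "('n, 'e) network \<Rightarrow> bool" where
  "gainy N \<longleftrightarrow> (\<forall>p. pre_digraph.cycle (graph N) p \<longrightarrow> walk_weight N p < 1)"

definition extend :: "('n::finite, 'e) network \<Rightarrow> real ^ 'n \<Rightarrow> 'n \<Rightarrow> real" where
  "extend N x v = (if v \<in> marked N then marking N v else x $ v)"


section \<open>Walks\<close>

text \<open>
  A finite walk carries its start node, so that walks of length \<open>0\<close> are represented;
  an infinite walk is determined by its sequence of arcs, indexed from \<open>0\<close>.
\<close>

datatype ('n, 'e) walk = Finite_Walk 'n "'e list" | Infinite_Walk "nat \<Rightarrow> 'e"

fun walk_start :: "('n, 'e) network \<Rightarrow> ('n, 'e) walk \<Rightarrow> 'n" where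
  "walk_start N (Finite_Walk u p) = u"
| "walk_start N (Infinite_Walk f) = tail (graph N) (f 0)"

inductive_set walks :: "('n, 'e) network \<Rightarrow> ('n, 'e) walk set" for N where
  finite_walk:
    "\<lbrakk>pre_digraph.awalk (graph N) u p v;
      set (butlast (pre_digraph.awalk_verts (graph N) u p)) \<subseteq> unmarked N;
      v \<in> marked N\<rbrakk>
     \<Longrightarrow> Finite_Walk u p \<in> walks N"
| infinite_walk:
    "(\<And>k. f k \<in> arcs (graph N) \<and> tail (graph N) (f k) \<in> unmarked N \<and>
           head (graph N) (f k) = tail (graph N) (f (Suc k)))
     \<Longrightarrow> Infinite_Walk f \<in> walks N"

text \<open>
  In the infinite case the nodes of positions \<open>0, \<dots>, r - 1\<close> are pairwise distinct and the
  arcs at positions \<open>s, \<dots>, r - 1\<close> are repeated forever.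
\<close>

fun path_or_monocycle :: "('n, 'e) network \<Rightarrow> ('n, 'e) walk \<Rightarrow> bool" where
  "path_or_monocycle N (Finite_Walk u p) \<longleftrightarrow>
     distinct (pre_digraph.awalk_verts (graph N) u p)"
| "path_or_monocycle N (Infinite_Walk f) \<longleftrightarrow>
     (\<exists>s r. s < r \<and> inj_on (\<lambda>k. tail (graph N) (f k)) {..<r} \<and>
            (\<forall>k\<ge>s. f (k + (r - s)) = f k))"

definition reduced_walks :: "('n, 'e) network \<Rightarrow> ('n, 'e) walk set" where
  "reduced_walks N = {W \<in> walks N. path_or_monocycle N W}"

text \<open>
  For infinite walks of a gainy network the series converges absolutely, so \<^const>\<open>suminf\<close>
  is its value.
\<close>

fun walk_sum :: "('n::finite, 'e) network \<Rightarrow> ('n, 'e) walk \<Rightarrow> real ^ 'n \<Rightarrow> real" where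
  "walk_sum N (Finite_Walk u p) x =
     (\<Sum>k<length p. (\<Prod>j<k. alpha N (p ! j)) *
        (extend N x (tail (graph N) (p ! k)) + cost N (p ! k))) +
     (\<Prod>j<length p. alpha N (p ! j)) * extend N x (pre_digraph.awlast (graph N) u p)"
| "walk_sum N (Infinite_Walk f) x =
     (\<Sum>k. (\<Prod>j<k. alpha N (f j)) *
        (extend N x (tail (graph N) (f k)) + cost N (f k)))"


section \<open>The polyhedron of a marked network\<close>

definition network_polyhedron :: "('n::finite, 'e) network \<Rightarrow> (real ^ 'n) set" where
  "network_polyhedron N =
     {y \<in> orthant (unmarked N).
        \<forall>a \<in> marked N. \<forall>e \<in> out_arcs (graph N) a. \<forall>W \<in> reduced_walks N.
          walk_start N W = head (graph N) e \<longrightarrow>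
          alpha N e * walk_sum N W y + cost N e \<le> marking N a}"

end

theory Submission
  imports Defs
begin

text \<open>
  For every reduced walk \<open>W\<close>, the map \<open>y \<mapsto> \<Sigma>(W)(y)\<close> is affine with componentwise nonnegative
  linear part, because all partial products of gains are positive. Hence each defining inequality
  is a half-space that is closed under decreasing coordinates, and there are only finitely many of
  them. The convergence of the series of a monocycle is the only place where gainyness enters: the
  partial products are multiplied by the weight of the cycle in each period.
\<close>

section \<open>Convergence of series that contract over each period\<close>

lemma summable_periodic_contraction:
  fixes g :: "nat \<Rightarrow> real"
  assumes nonneg: "\<And>k. 0 \<le> g k" and "w < 1"
    and step: "\<And>k. s \<le> k \<Longrightarrow> g (k + p) \<le> w * g k"
  shows "summable g"
proof (cases "w \<le> 0")
  case True
  \<comment> \<open>For nonpositive \<open>w\<close>, contraction and nonnegativity force every term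
    from \<open>s + p\<close> on to vanish.\<close>
  have "g k = 0" if "k \<ge> s + p" for k
  proof -
    have "g k \<le> w * g (k - p)" using step[of "k - p"] that by simp
    also have "\<dots> \<le> 0" using True nonneg by (simp add: mult_nonpos_nonneg)
    finally show ?thesis using nonneg[of k] by simp
  qed
  then show ?thesis by (intro summable_finite[of "{..<s + p}"]) auto
next
  case False
  \<comment> \<open>Let T be the sum of the first \<open>s + n\<close> terms and C that of the first
    \<open>s + p\<close>. Extending T by \<open>p\<close> terms, splitting off C and shifting the
    remainder by \<open>p\<close> gives T \<le> C + \<open>w\<close> T. Solving for T yields a bound
    independent of \<open>n\<close>.\<close>
  have bound: "(\<Sum>k<n. g k) \<le> (\<Sum>k<s + p. g k) / (1 - w)" for n
  proof -
    have split: "{..<s + p + n} = {..<s + p} \<union> {s + p..<s + n + p}"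
      by auto
    have "(\<Sum>k<n. g k) \<le> (\<Sum>k<s + n. g k)"
      by (intro sum_mono2) (auto simp: nonneg)
    moreover have "(\<Sum>k<s + n. g k) \<le> (\<Sum>k<s + p + n. g k)"
      by (intro sum_mono2) (auto simp: nonneg)
    moreover have "(\<Sum>k<s + p + n. g k) = (\<Sum>k<s + p. g k) + (\<Sum>k=s + p..<s + n + p. g k)"
      unfolding split by (rule sum.union_disjoint) auto
    moreover have "(\<Sum>k=s + p..<s + n + p. g k) = (\<Sum>k=s..<s + n. g (k + p))"
      by (rule sum.shift_bounds_nat_ivl)
    moreover have "\<dots> \<le> (\<Sum>k=s..<s + n. w * g k)"
      by (intro sum_mono step) auto
    moreover have "\<dots> = w * (\<Sum>k=s..<s + n. g k)"
      by (simp add: sum_distrib_left)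
    moreover have "\<dots> \<le> w * (\<Sum>k<s + n. g k)"
      using False by (intro mult_left_mono sum_mono2) (auto simp: nonneg)
    ultimately have "(\<Sum>k<n. g k) \<le> (\<Sum>k<s + n. g k)"
      and "(1 - w) * (\<Sum>k<s + n. g k) \<le> (\<Sum>k<s + p. g k)"
      by (simp_all add: algebra_simps)
    moreover from this(2) have "(\<Sum>k<s + n. g k) \<le> (\<Sum>k<s + p. g k) / (1 - w)"
      using \<open>w < 1\<close> by (simp add: pos_le_divide_eq mult.commute)
    ultimately show ?thesis by linarith
  qed
  then show ?thesis by (intro summableI_nonneg_bounded) (auto simp: nonneg)
qed

section \<open>Affine functions with nonnegative linear part\<close>

definition monotone_affine :: "(real ^ 'n \<Rightarrow> real) \<Rightarrow> bool" where
  "monotone_affine h \<longleftrightarrow> (\<exists>a b. (\<forall>i. 0 \<le> a $ i) \<and> (\<forall>y. h y = a \<bullet> y + b))"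

lemma monotone_affine_mono:
  assumes "monotone_affine h" "\<And>i. x $ i \<le> y $ i"
  shows "h x \<le> h y"
proof -
  obtain a b where "\<forall>i. 0 \<le> a $ i" "\<forall>y. h y = a \<bullet> y + b"
    using assms(1) by (auto simp: monotone_affine_def)
  moreover from this have "a \<bullet> x \<le> a \<bullet> y"
    unfolding inner_vec_def using assms(2) by (intro sum_mono) (simp add: mult_left_mono)
  ultimately show ?thesis by simp
qed

lemma monotone_affine_polyhedron:
  assumes "monotone_affine h"
  shows "polyhedron {y. h y \<le> t}"
proof -
  obtain a b where "\<forall>y. h y = a \<bullet> y + b"
    using assms by (auto simp: monotone_affine_def)
  then have "{y. h y \<le> t} = {y. a \<bullet> y \<le> t - b}" by auto
  then show ?thesis by (simp add: polyhedron_halfspace_le)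
qed

lemma monotone_affine_const: "monotone_affine (\<lambda>_. t)"
  unfolding monotone_affine_def by (intro exI[of _ 0] exI[of _ t]) auto

lemma monotone_affine_add:
  assumes "monotone_affine f" "monotone_affine g"
  shows "monotone_affine (\<lambda>y. f y + g y)"
proof -
  obtain a b a' b' where "\<forall>i. 0 \<le> a $ i" "\<forall>y. f y = a \<bullet> y + b"
      "\<forall>i. 0 \<le> a' $ i" "\<forall>y. g y = a' \<bullet> y + b'"
    using assms unfolding monotone_affine_def by blast
  then show ?thesis unfolding monotone_affine_def
    by (intro exI[of _ "a + a'"] exI[of _ "b + b'"]) (auto simp: inner_add_left)
qed

lemma monotone_affine_mult:
  assumes "monotone_affine f" "0 \<le> t"
  shows "monotone_affine (\<lambda>y. t * f y)"
proof -
  obtain a b where "\<forall>i. 0 \<le> a $ i" "\<forall>y. f y = a \<bullet> y + b"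
    using assms unfolding monotone_affine_def by blast
  then show ?thesis using assms(2) unfolding monotone_affine_def
    by (intro exI[of _ "t *\<^sub>R a"] exI[of _ "t * b"]) (auto simp: distrib_left)
qed

lemma monotone_affine_sum:
  assumes "\<And>k. k \<in> K \<Longrightarrow> monotone_affine (f k)"
  shows "monotone_affine (\<lambda>y. \<Sum>k\<in>K. f k y)"
  using assms
  \<comment> \<open>For infinite \<open>K\<close> the sum is 0 by convention, hence
    constant.\<close>
  by (induction K rule: infinite_finite_induct)
    (auto intro: monotone_affine_const monotone_affine_add)

lemma monotone_affine_extend: "monotone_affine (\<lambda>y. extend N y v)"
  unfolding monotone_affine_def extend_def
  by (intro exI[of _ "if v \<in> marked N then 0 else axis v 1"]
        exI[of _ "if v \<in> marked N then marking N v else 0"])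
    (auto simp: inner_axis', simp add: axis_def)

text \<open>Since the terms come from the finite family \<open>h j\<close>, their coefficients are
  uniformly bounded. The series of linear parts and of constants are therefore dominated by a
  multiple of \<open>P\<close> and can be summed separately.\<close>

lemma monotone_affine_suminf:
  fixes P :: "nat \<Rightarrow> real" and h :: "'k \<Rightarrow> real ^ 'n \<Rightarrow> real"
  assumes P: "\<And>k. 0 \<le> P k" "summable P"
    and h: "finite K" "\<And>j. j \<in> K \<Longrightarrow> monotone_affine (h j)" "\<And>k. f k \<in> K"
  shows "monotone_affine (\<lambda>y. \<Sum>k. P k * h (f k) y)"
proof -
  from h(2) have "\<forall>j\<in>K. \<exists>a b. (\<forall>i. 0 \<le> a $ i) \<and> (\<forall>y. h j y = a \<bullet> y + b)"
    by (simp add: monotone_affine_def)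
  then obtain a b where ab: "\<And>j i. j \<in> K \<Longrightarrow> 0 \<le> a j $ i"
      "\<And>j y. j \<in> K \<Longrightarrow> h j y = a j \<bullet> y + b j"
    unfolding bchoice_iff by blast
  define A where "A k = P k *\<^sub>R a (f k)" for k
  define B where "B k = P k * b (f k)" for k
  \<comment> \<open>Summing over the finite set \<open>K\<close> bounds all gradients and constants
    at once.\<close>
  define M where "M = (\<Sum>j\<in>K. norm (a j) + \<bar>b j\<bar>)"
  have M: "norm (a (f k)) + \<bar>b (f k)\<bar> \<le> M" for k
    unfolding M_def using h(1,3) by (intro member_le_sum) auto
  have sum_PM: "summable (\<lambda>k. P k * M)" using P(2) by (rule summable_mult2)
  have sA: "summable A"
  proof (rule summable_comparison_test'[OF sum_PM])
    have "norm (a (f k)) \<le> M" for k using M[of k] by linarith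
    then show "norm (A k) \<le> P k * M" for k
      using P(1) by (simp add: A_def mult_left_mono)
  qed
  have sB: "summable B"
  proof (rule summable_comparison_test'[OF sum_PM])
    have "\<bar>b (f k)\<bar> \<le> M" for k using M[of k] norm_ge_zero[of "a (f k)"] by linarith
    then show "norm (B k) \<le> P k * M" for k
      using P(1) by (simp add: B_def abs_mult mult_left_mono)
  qed
  have "0 \<le> suminf A $ i" for i
  proof -
    \<comment> \<open>Taking a coordinate is bounded linear, so it commutes with the convergent
      series.\<close>
    have "suminf A $ i = (\<Sum>k. A k $ i)"
      by (rule bounded_linear.suminf[OF bounded_linear_vec_nth sA])
    also have "\<dots> \<ge> 0"
      by (rule suminf_nonneg[OF bounded_linear.summable[OF bounded_linear_vec_nth sA]])
        (simp add: A_def P(1) ab(1) h(3))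
    finally show ?thesis .
  qed
  moreover have "(\<Sum>k. P k * h (f k) y) = suminf A \<bullet> y + suminf B" for y
  proof -
    have "(\<Sum>k. P k * h (f k) y) = (\<Sum>k. A k \<bullet> y + B k)"
      by (simp add: A_def B_def ab(2) h(3) distrib_left)
    also have "\<dots> = (\<Sum>k. A k \<bullet> y) + suminf B"
      by (intro suminf_add[symmetric] sB bounded_linear.summable[OF bounded_linear_inner_left sA])
    also have "(\<Sum>k. A k \<bullet> y) = suminf A \<bullet> y"
      by (rule bounded_linear.suminf[OF bounded_linear_inner_left sA, symmetric])
    finally show ?thesis .
  qed
  ultimately show ?thesis unfolding monotone_affine_def by blast
qed

section \<open>Finite segments of infinite walks\<close>

context wf_digraph
begin

text \<open>Naming the end node as the tail of the next arc covers the empty segment too and lets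
  the induction append one arc at a time.\<close>

lemma awalk_infinite_segment:
  assumes "\<And>k. f k \<in> arcs G" "\<And>k. head G (f k) = tail G (f (Suc k))"
  shows "awalk (tail G (f s)) (map f [s..<s + n]) (tail G (f (s + n)))"
proof (induction n)
  case 0
  then show ?case by (simp add: awalk_Nil_iff assms(1))
next
  case (Suc n)
  have "awalk (tail G (f (s + n))) [f (s + n)] (tail G (f (s + Suc n)))"
    using arc_implies_awalk[OF assms(1)[of "s + n"]] assms(2)[of "s + n"] by simp
  from awalk_appendI[OF Suc this] show ?case by simp
qed

lemma cycle_infinite_segment:
  assumes f: "\<And>k. f k \<in> arcs G" "\<And>k. head G (f k) = tail G (f (Suc k))"
    and "s < r" "inj_on (\<lambda>k. tail G (f k)) {..<r}" "tail G (f r) = tail G (f s)"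
  shows "cycle (map f [s..<r])"
proof -
  let ?t = "\<lambda>k. tail G (f k)"
  have "awalk (?t s) (map f [s..<r]) (?t s)"
    using awalk_infinite_segment[of f s "r - s", OF f] assms(3,5) by simp
  \<comment> \<open>\<open>cycle\<close> demands distinctness after the first node is dropped: the
    base node then occurs only at the end, as the head of arc \<open>f (r - 1)\<close>.\<close>
  moreover have "tl (awalk_verts (?t s) (map f [s..<r])) = map ?t [Suc s..<r] @ [?t s]"
  proof -
    have "map f [s..<r] = f s # map f [Suc s..<r]"
      using assms(3) by (simp add: upt_conv_Cons)
    moreover have "last (map f [s..<r]) = f (r - 1)"
      using assms(3) by (subst last_map) auto
    moreover have "head G (f (r - 1)) = ?t s" using assms(3,5) f(2)[of "r - 1"] by simp
    ultimately show ?thesis using assms(3) by (simp only: awalk_verts_conv) simp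
  qed
  moreover have "distinct (map ?t [Suc s..<r] @ [?t s])"
  proof -
    have "inj_on ?t {Suc s..<r}" using assms(4) by (rule inj_on_subset) auto
    moreover have "?t s \<notin> ?t ` {Suc s..<r}"
      by (auto dest: inj_onD[OF assms(4)])
    ultimately show ?thesis by (simp add: distinct_map)
  qed
  ultimately show ?thesis using assms(3) unfolding cycle_def by auto
qed

end

section \<open>Reduced walks of a marked network\<close>

context
  fixes N :: "('n::finite, 'e) network"
  assumes N: "marked_network N"
begin

interpretation fin_digraph "graph N"
  using N by (simp add: marked_network_def)

lemma network_alpha_pos: "e \<in> arcs (graph N) \<Longrightarrow> 0 < alpha N e"
  using N by (simp add: marked_network_def)

lemma monocycle_summable:
  assumes "gainy N" "Infinite_Walk f \<in> reduced_walks N"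
  shows "summable (\<lambda>k. \<Prod>j<k. alpha N (f j))"
proof -
  from assms(2) have f: "\<And>k. f k \<in> arcs (graph N)"
      "\<And>k. head (graph N) (f k) = tail (graph N) (f (Suc k))"
    by (auto simp: reduced_walks_def elim: walks.cases)
  from assms(2) obtain s r where sr: "s < r" "inj_on (\<lambda>k. tail (graph N) (f k)) {..<r}"
      "\<And>k. k \<ge> s \<Longrightarrow> f (k + (r - s)) = f k"
    by (auto simp: reduced_walks_def)
  define w where "w = walk_weight N (map f [s..<r])"
  \<comment> \<open>Periodicity at position \<open>s\<close> closes the segment, so gainyness
    applies to it.\<close>
  have "f r = f s" using sr(1) sr(3)[of s] by simp
  then have "cycle (map f [s..<r])"
    using cycle_infinite_segment[OF f sr(1,2)] by simp
  then have "w < 1" using assms(1) by (simp add: gainy_def w_def)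
  define g where "g k = (\<Prod>j<k. alpha N (f j))" for k
  \<comment> \<open>At \<open>k = s\<close> the product up to \<open>r\<close> splits into the
    initial part and one round of the cycle. Increasing \<open>k\<close> multiplies both sides by
    the same factor, because \<open>f\<close> is periodic from \<open>s\<close> on.\<close>
  have "g (k + (r - s)) = w * g k" if "s \<le> k" for k
    using that
  proof (induction k rule: dec_induct)
    case base
    have "{..<r} = {..<s} \<union> {s..<r}" using sr(1) by auto
    then have "g r = g s * (\<Prod>j=s..<r. alpha N (f j))"
      unfolding g_def by (simp add: prod.union_disjoint ivl_disj_int)
    also have "(\<Prod>j=s..<r. alpha N (f j)) = w"
      by (simp add: w_def walk_weight_def comp_def prod.distinct_set_conv_list[symmetric])
    finally show ?case using sr(1) by simp
  next
    case (step k)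
    then show ?case using sr(3)[of k] by (simp add: g_def)
  qed
  moreover have "0 \<le> g k" for k
    unfolding g_def by (intro prod_nonneg) (simp add: network_alpha_pos f less_imp_le)
  ultimately have "summable g"
    using \<open>w < 1\<close> by (intro summable_periodic_contraction[of g w s "r - s"]) auto
  then show ?thesis by (simp add: g_def[abs_def])
qed

lemma monotone_affine_walk_sum:
  assumes "gainy N" "W \<in> reduced_walks N"
  shows "monotone_affine (walk_sum N W)"
proof (cases W)
  case (Finite_Walk u p)
  then have p: "set p \<subseteq> arcs (graph N)"
    using assms(2) by (auto simp: reduced_walks_def elim!: walks.cases)
  \<comment> \<open>Allowing \<open>k = length p\<close> also covers the coefficient of the end
    node.\<close>
  have "0 \<le> (\<Prod>j<k. alpha N (p ! j))" if "k \<le> length p" for k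
    using that p by (intro prod_nonneg) (auto intro!: less_imp_le network_alpha_pos)
  then show ?thesis
    unfolding Finite_Walk walk_sum.simps
    by (intro monotone_affine_add monotone_affine_sum monotone_affine_mult
        monotone_affine_extend monotone_affine_const) auto
next
  case (Infinite_Walk f)
  then have f: "f k \<in> arcs (graph N)" for k
    using assms(2) by (auto simp: reduced_walks_def elim: walks.cases)
  \<comment> \<open>Apart from its coefficient, the term at position \<open>k\<close> depends only
    on the arc \<open>f k\<close>, so the finite arc set can index the family.\<close>
  show ?thesis
    unfolding Infinite_Walk walk_sum.simps
  proof (rule monotone_affine_suminf[where K = "arcs (graph N)"
        and h = "\<lambda>e y. extend N y (tail (graph N) e) + cost N e" and f = f])
    show "0 \<le> (\<Prod>j<k. alpha N (f j))" for k
      by (intro prod_nonneg) (simp add: network_alpha_pos f less_imp_le)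
    show "summable (\<lambda>k. \<Prod>j<k. alpha N (f j))"
      using assms Infinite_Walk by (simp add: monocycle_summable)
  qed (auto intro: monotone_affine_add monotone_affine_extend monotone_affine_const f)
qed

text \<open>Bounded data determine a reduced walk: a start node and an arc list for a path, the
  entry position \<open>s\<close> and the first \<open>r\<close> arcs for a monocycle. Distinctness
  of nodes bounds the list lengths by \<open>CARD('n)\<close>.\<close>

lemma finite_reduced_walks: "finite (reduced_walks N)"
proof -
  define L where "L = {p. set p \<subseteq> arcs (graph N) \<and> length p \<le> CARD('n)}"
  have "finite L" unfolding L_def by (intro finite_lists_length_le) simp
  \<comment> \<open>\<open>rho s p\<close> unrolls \<open>p\<close> to an infinite sequence: the
    first \<open>s\<close> arcs once, then the remaining ones with period
    \<open>length p - s\<close>.\<close>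
  define rho :: "nat \<Rightarrow> 'e list \<Rightarrow> nat \<Rightarrow> 'e" where
    "rho s p k = (if k < s then p ! k else p ! (s + (k - s) mod (length p - s)))" for s p k
  have "reduced_walks N \<subseteq> (\<lambda>(u, p). Finite_Walk u p) ` (UNIV \<times> L) \<union>
      (\<lambda>(s, p). Infinite_Walk (rho s p)) ` ({..<CARD('n)} \<times> L)"
  proof
    fix W assume W: "W \<in> reduced_walks N"
    show "W \<in> (\<lambda>(u, p). Finite_Walk u p) ` (UNIV \<times> L) \<union>
        (\<lambda>(s, p). Infinite_Walk (rho s p)) ` ({..<CARD('n)} \<times> L)"
    proof (cases W)
      case (Finite_Walk u p)
      with W have p: "set p \<subseteq> arcs (graph N)" "distinct (awalk_verts u p)"
        by (auto simp: reduced_walks_def elim!: walks.cases)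
      have "Suc (length p) = card (set (awalk_verts u p))"
        using distinct_card[OF p(2)] by (simp add: length_awalk_verts)
      also have "\<dots> \<le> CARD('n)" by (intro card_mono) auto
      finally have "p \<in> L" using p(1) by (simp add: L_def)
      then show ?thesis using Finite_Walk by auto
    next
      case (Infinite_Walk f)
      with W have f: "f k \<in> arcs (graph N)" for k
        by (auto simp: reduced_walks_def elim: walks.cases)
      from W Infinite_Walk obtain s r
        where sr: "s < r" "inj_on (\<lambda>k. tail (graph N) (f k)) {..<r}"
          "\<And>k. k \<ge> s \<Longrightarrow> f (k + (r - s)) = f k"
        by (auto simp: reduced_walks_def)
      have "r \<le> CARD('n)"
        using card_inj_on_le[OF sr(2), of UNIV] by simp
      have mult: "f (k + m * (r - s)) = f k" if "k \<ge> s" for k m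
      proof (induction m)
        case (Suc m)
        have "f (k + Suc m * (r - s)) = f (k + m * (r - s) + (r - s))"
          by (simp add: ac_simps)
        also have "\<dots> = f k" using sr(3)[of "k + m * (r - s)"] that Suc by simp
        finally show ?case .
      qed simp
      have "f k = rho s (map f [0..<r]) k" for k
      proof (cases "k < s")
        case True
        then show ?thesis using sr(1) by (simp add: rho_def)
      next
        case False
        \<comment> \<open>Division with remainder moves \<open>k\<close> back by \<open>?d\<close>
          whole periods to the position \<open>s + ?m\<close> in the first round.\<close>
        let ?m = "(k - s) mod (r - s)" and ?d = "(k - s) div (r - s)"
        have "k = s + ?m + ?d * (r - s)"
          using False mod_div_mult_eq[of "k - s" "r - s"] by linarith
        then have "f k = f (s + ?m)" using mult[of "s + ?m" ?d] by simp
        moreover have "s + ?m < r"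
          using sr(1) mod_less_divisor[of "r - s" "k - s"] by linarith
        ultimately show ?thesis using False by (simp add: rho_def)
      qed
      then have "W = Infinite_Walk (rho s (map f [0..<r]))"
        using Infinite_Walk by auto
      moreover have "map f [0..<r] \<in> L" using f \<open>r \<le> CARD('n)\<close> by (auto simp: L_def)
      moreover have "s < CARD('n)" using sr(1) \<open>r \<le> CARD('n)\<close> by simp
      ultimately show ?thesis by auto
    qed
  qed
  then show ?thesis by (rule finite_subset) (simp add: \<open>finite L\<close>)
qed

end

section \<open>The network polyhedron as a finite intersection of half-spaces\<close>

lemma polyhedron_orthant: "polyhedron (orthant V)"
proof -
  have "orthant V = (\<Inter>i\<in>-V. {x. axis i 1 \<bullet> x = 0}) \<inter> (\<Inter>i\<in>V. {x. axis i 1 \<bullet> x \<ge> 0})"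
    by (auto simp: orthant_def coord_space_def inner_axis')
  then show ?thesis
    by (auto intro!: polyhedron_Int polyhedron_Inter polyhedron_hyperplane polyhedron_halfspace_ge)
qed

theorem corollary4p4:
  fixes N :: "('n::finite, 'e) network"
  assumes "marked_network N"
    and "gainy N"
    and "all_sinks_marked N"
  shows "anti_blocking (unmarked N) (network_polyhedron N)"
proof -
  \<comment> \<open>\<open>S\<close> indexes the walk inequalities; its finiteness, inherited from
    arcs and reduced walks, is what makes their intersection a polyhedron.\<close>
  define S where "S = {(a, e, W). a \<in> marked N \<and> e \<in> out_arcs (graph N) a \<and>
    W \<in> reduced_walks N \<and> walk_start N W = head (graph N) e}"
  define h where "h e W y = alpha N e * walk_sum N W y + cost N e" for e W y
  have poly_eq: "network_polyhedron N =
      orthant (unmarked N) \<inter> (\<Inter>(a, e, W)\<in>S. {y. h e W y \<le> marking N a})"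
    by (fastforce simp: network_polyhedron_def S_def h_def)
  have h: "monotone_affine (h e W)" if "(a, e, W) \<in> S" for a e W
    using that assms(1,2) unfolding h_def
    by (intro monotone_affine_add monotone_affine_mult monotone_affine_walk_sum
        monotone_affine_const) (auto simp: S_def intro!: less_imp_le network_alpha_pos)
  have "finite (arcs (graph N))"
    using assms(1) by (simp add: marked_network_def fin_digraph.finite_arcs)
  then have "finite ((UNIV :: 'n set) \<times> arcs (graph N) \<times> reduced_walks N)"
    using finite_reduced_walks[OF assms(1)] by simp
  then have "finite S" by (rule rev_finite_subset) (auto simp: S_def)
  then have "polyhedron (network_polyhedron N)"
    unfolding poly_eq using h
    by (intro polyhedron_Int polyhedron_orthant polyhedron_Inter)
      (auto intro!: monotone_affine_polyhedron)
  moreover have "x \<in> network_polyhedron N"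
    if y: "y \<in> network_polyhedron N" and x: "x \<in> orthant (unmarked N)"
      and le: "\<forall>i\<in>unmarked N. x $ i \<le> y $ i" for x y
  proof -
    \<comment> \<open>\<open>monotone_affine_mono\<close> compares all coordinates; outside
      \<open>unmarked N\<close> both vectors vanish.\<close>
    have "x $ i \<le> y $ i" for i
      using x y le by (cases "i \<in> unmarked N") (auto simp: poly_eq orthant_def coord_space_def)
    then have "h e W x \<le> h e W y" if "(a, e, W) \<in> S" for a e W
      using monotone_affine_mono[OF h[OF that]] by blast
    then show ?thesis using x y by (fastforce simp: poly_eq)
  qed
  ultimately show ?thesis
    unfolding anti_blocking_def by (auto simp: poly_eq)
qed

end
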